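(* Let $\Omega\subset\mathbb{C}$ be a domain and let $f$ be a holomorphic function on $\Omega$. Let $\widehat{\Omega}$ be the intersection of all simply connected domains $G$ with $\Omega\subset G\subset\mathbb{C}$; equivalently, $\widehat{\Omega}=X^c$ is the complement of $X$, where $X$ is the connected component of $\infty$ in $(\mathbb{C}\cup\{\infty\})\setminus\Omega$. Then the following are equivalent. (1) The function $f$ admits one-valued primitives of all orders; that is, for every $n=1,2,\ldots$ there exists a holomorphic function $\varphi_n$ on $\Omega$ whose $n$-th derivative satisfies $\varphi_n^{(n)}=f$ on $\Omega$. (2) For every closed polygonal line $\gamma$ in $\Omega$ and every complex polynomial $P$ we have $\int_\gamma P(z)f(z)\,dz=0$. (3) The function $f$ has a holomorphic extension to $\widehat{\Omega}$.
   Context: A domain is a nonempty connected open subset of $\mathbb{C}$. $\mathbb{C}\cup\{\infty\}$ is the Riemann sphere, and the complement $X^c$ is taken in it (it is contained in $\mathbb{C}$ because $\infty\in X$). A closed polygonal line (closed polygonal curve) in $\Omega$ is a closed curve in $\Omega$ consisting of finitely many line segments. A holomorphic extension of $f$ to $\widehat{\Omega}$ is a holomorphic function on $\widehat{\Omega}$ whose restriction to $\Omega$ is $f$. *)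

theory Defs
  imports "HOL-Complex_Analysis.Complex_Analysis" "HOL-Computational_Algebra.Polynomial"
begin

definition complex_domain :: "complex set \<Rightarrow> bool" where
  "complex_domain G \<longleftrightarrow> G \<noteq> {} \<and> open G \<and> connected G"

definition simply_connected_hull :: "complex set \<Rightarrow> complex set" where
  "simply_connected_hull \<Omega> = \<Inter> {G. complex_domain G \<and> simply_connected G \<and> \<Omega> \<subseteq> G}"

(* The point None is infinity, and Some z is the finite point z. *)
definition riemann_sphere :: "complex option topology" where
  "riemann_sphere = Alexandroff_compactification euclidean"

definition component_of_infinity :: "complex set \<Rightarrow> complex option set" where
  "component_of_infinity \<Omega> =
     connected_component_of_set
       (subtopology riemann_sphere (topspace riemann_sphere - Some ` \<Omega>)) None"

(* The parametrization produced by linepath and (+++) is immaterial for contour integrals.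
   Degenerate segments and self-intersections are allowed. *)
inductive polygonal_line :: "(real \<Rightarrow> complex) \<Rightarrow> bool" where
  segment: "polygonal_line (linepath a b)"
| join: "polygonal_line g \<Longrightarrow> polygonal_line h \<Longrightarrow> pathfinish g = pathstart h
           \<Longrightarrow> polygonal_line (g +++ h)"

definition closed_polygonal_line_in :: "complex set \<Rightarrow> (real \<Rightarrow> complex) \<Rightarrow> bool" where
  "closed_polygonal_line_in \<Omega> \<gamma> \<longleftrightarrow>
     polygonal_line \<gamma> \<and> pathfinish \<gamma> = pathstart \<gamma> \<and> path_image \<gamma> \<subseteq> \<Omega>"

definition has_primitives_of_all_orders :: "complex set \<Rightarrow> (complex \<Rightarrow> complex) \<Rightarrow> bool" where
  "has_primitives_of_all_orders \<Omega> f \<longleftrightarrow>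
     (\<forall>n\<ge>1. \<exists>\<phi>. \<phi> holomorphic_on \<Omega> \<and> (\<forall>z\<in>\<Omega>. (deriv ^^ n) \<phi> z = f z))"

definition has_holomorphic_extension ::
    "complex set \<Rightarrow> (complex \<Rightarrow> complex) \<Rightarrow> complex set \<Rightarrow> bool" where
  "has_holomorphic_extension \<Omega> f G \<longleftrightarrow>
     (\<exists>F. F holomorphic_on G \<and> (\<forall>z\<in>\<Omega>. F z = f z))"

end

theory Submission
  imports Defs
begin

text \<open>
  The hull is determined topologically: it is \<open>\<Omega> \<union> inside \<Omega> = - outside \<Omega>\<close>, where \<open>inside \<Omega>\<close> collects the
  bounded components of \<open>- \<Omega>\<close>. Simply connected domains are exactly the domains whose complement
  has only unbounded components, so any of them that contains \<open>\<Omega>\<close> contains \<open>inside \<Omega>\<close>, while filling in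
  \<open>inside \<Omega>\<close> leaves only unbounded components. On the sphere, the unbounded components are precisely
  those that are glued together at infinity. The one topological tool behind both descriptions is
  the Sura--Bura theorem: a bounded component of the closed set \<open>- \<Omega>\<close> lies in a compact set of the form
  \<open>V - \<Omega>\<close> with \<open>V\<close> open (lemma \<open>compact_piece_of_complement\<close>), hence it can be split off from the rest.

  The three analytic conditions are linked in a cycle.

  \<^item> From primitives to integrals: if \<open>\<phi>\<close> is a primitive of \<open>f\<close> of order \<open>degree P + 1\<close>, then repeated
    integration by parts writes down a primitive of \<open>P f\<close>, so the integral over any closed curve vanishes.

  \<^item> From integrals to the extension: first, all \<open>z\<^sup>n f\<close> acquire primitives on \<open>\<Omega>\<close>. Let \<open>K = V - \<Omega>\<close> be a
    compact piece of the complement and surround it by two cycles in \<open>V - K \<subseteq> \<Omega>\<close>, an outer one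
    and an inner one. Cauchy's formula gives \<open>2 \<pi> \<i> f = A - B\<close> between them, where \<open>A\<close> and \<open>B\<close> are the
    Cauchy transforms of \<open>f\<close> along the outer and the inner cycle. Since \<open>A\<close> is holomorphic on a whole
    neighbourhood of \<open>K\<close>, the function that equals \<open>A - 2 \<pi> \<i> f\<close> near \<open>K\<close> and \<open>B\<close> far from \<open>K\<close> is holomorphic on
    \<open>- K\<close>. It vanishes near infinity, because its Laurent coefficients there are, up to
    a constant factor, the moments \<open>\<integral> w\<^sup>n f(w) dw\<close>, and \<open>- K\<close> is connected because \<open>\<Omega>\<close> is. So it vanishes
    identically, and \<open>A / (2 \<pi> \<i>)\<close> extends \<open>f\<close> across \<open>K\<close> (lemma \<open>extension_across_compact\<close>).
    Local extensions agree by the maximum principle and can be glued (lemma \<open>extension_to_hull\<close>).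

  \<^item> From the extension to primitives: on the simply connected hull every holomorphic function has a
    primitive, and this can be iterated.

  The cycles consist of edges of a square grid. That they close up takes the form that the increments of
  any function along their edges sum to zero.
\<close>

section \<open>Separating bounded complementary components\<close>

text \<open>
  The bounded component through \<open>x\<close> is compact, so Sura--Bura provides a relatively open compact set
  around it; being relatively open, that set is cut out of the complement by an open \<open>V\<close>.
\<close>

lemma compact_piece_of_complement:
  fixes \<Omega> :: "'a::euclidean_space set"
  assumes "open \<Omega>" "x \<in> inside \<Omega>"
  obtains V where "open V" "x \<in> V" "compact (V - \<Omega>)"
proof -
  define C where "C = connected_component_set (- \<Omega>) x"
  have x: "x \<notin> \<Omega>" "bounded C"
    using assms(2) by (auto simp: inside_def C_def)
  have comp: "C \<in> components (- \<Omega>)"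
    using x by (auto simp: C_def components_def)
  have "closed C"
    using closed_components[OF _ comp] assms(1) by auto
  then have "compact C"
    using x compact_eq_bounded_closed by blast
  moreover have "locally compact (- \<Omega>)"
    using assms(1) by (intro closed_imp_locally_compact) auto
  ultimately obtain K where K: "openin (top_of_set (- \<Omega>)) K" "compact K" "C \<subseteq> K"
    using Sura_Bura_clopen_subset[OF _ comp _ open_UNIV] by (metis subset_UNIV)
  from K(1) obtain V where V: "open V" "K = - \<Omega> \<inter> V"
    by (meson openin_open)
  have "x \<in> C"
    using x by (simp add: C_def)
  moreover have "V - \<Omega> = K"
    using V by auto
  ultimately show thesis
    using K V by (intro that[of V]) auto
qed

text \<open>
  A compact piece \<open>V - \<Omega>\<close> is relatively clopen in the complement, so it swallows every component
  that it meets, and these are then bounded.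
\<close>

lemma compact_piece_subset_inside:
  fixes \<Omega> :: "'a::euclidean_space set"
  assumes "open V" "compact (V - \<Omega>)"
  shows "V - \<Omega> \<subseteq> inside \<Omega>"
proof
  fix y assume y: "y \<in> V - \<Omega>"
  let ?C = "connected_component_set (- \<Omega>) y"
  have C: "?C \<inter> V = ?C \<inter> (V - \<Omega>)"
    using connected_component_subset by blast
  have "openin (top_of_set ?C) (?C \<inter> V)"
    using assms(1) by (simp add: openin_open_Int)
  moreover have "closedin (top_of_set ?C) (?C \<inter> V)"
    unfolding C using assms(2) by (intro closedin_closed_Int compact_imp_closed)
  moreover have "y \<in> ?C \<inter> V"
    using y by simp
  ultimately have "?C \<inter> V = ?C"
    using connected_connected_component[of "- \<Omega>" y] unfolding connected_clopen by blast
  then have "?C \<subseteq> V - \<Omega>"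
    using C by blast
  then show "y \<in> inside \<Omega>"
    using y assms(2) bounded_subset compact_imp_bounded by (auto simp: inside_def)
qed

lemma closed_outside_open:
  fixes \<Omega> :: "'a::euclidean_space set"
  assumes "open \<Omega>"
  shows "closed (outside \<Omega>)"
proof -
  have "open (\<Omega> \<union> inside \<Omega>)"
  proof (subst open_subopen, intro ballI)
    fix x assume "x \<in> \<Omega> \<union> inside \<Omega>"
    then show "\<exists>T. open T \<and> x \<in> T \<and> T \<subseteq> \<Omega> \<union> inside \<Omega>"
    proof
      assume "x \<in> inside \<Omega>"
      then obtain V where "open V" "x \<in> V" "compact (V - \<Omega>)"
        using compact_piece_of_complement[OF assms] by blast
      then show ?thesis
        using compact_piece_subset_inside by (intro exI[of _ V]) blast
    qed (use assms in blast)
  qed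
  then show ?thesis
    by (simp add: outside_inside open_closed)
qed

lemma connected_if_components_meet:
  assumes "connected A" "A \<subseteq> S" "\<And>C. C \<in> components S \<Longrightarrow> C \<inter> A \<noteq> {}"
  shows "connected S"
proof (rule connected_iff_eq_connected_component_set[THEN iffD2], intro ballI)
  fix x assume "x \<in> S"
  let ?C = "connected_component_set S x"
  have meets: "A \<subseteq> connected_component_set S y" if "y \<in> S" for y
  proof -
    have "connected_component_set S y \<in> components S"
      using that by (auto simp: components_def)
    then obtain a where a: "a \<in> connected_component_set S y" "a \<in> A"
      using assms(3) by blast
    have "A \<subseteq> connected_component_set S a"
      using a assms(1,2) by (simp add: connected_component_maximal)
    then show ?thesis
      using a(1) connected_component_eq by blast
  qed
  show "?C = S"
  proof
    show "?C \<subseteq> S" by (rule connected_component_subset)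
    show "S \<subseteq> ?C"
    proof
      fix y assume "y \<in> S"
      then have "connected_component_set S y \<in> components S"
        by (auto simp: components_def)
      then obtain a where "a \<in> A" using assms(3) by blast
      then have "connected_component S x a" "connected_component S y a"
        using meets \<open>x \<in> S\<close> \<open>y \<in> S\<close> by blast+
      then show "y \<in> ?C"
        by (metis connected_component_sym connected_component_trans mem_Collect_eq)
    qed
  qed
qed

text \<open>
  A component of the complement of the piece \<open>K = V - \<Omega>\<close>, unless it is the whole space, has a boundary
  point in \<open>K\<close>, hence in \<open>V\<close>, so it has points in \<open>V - K \<subseteq> \<Omega>\<close>. All components therefore meet the connected set \<open>\<Omega>\<close>.
\<close>

lemma connected_complement_of_piece:
  fixes \<Omega> :: "'a::euclidean_space set"
  assumes "connected \<Omega>" "\<Omega> \<noteq> {}" "open V" "compact (V - \<Omega>)"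
  shows "connected (- (V - \<Omega>))"
proof (rule connected_if_components_meet[OF assms(1)])
  fix C assume C: "C \<in> components (- (V - \<Omega>))"
  show "C \<inter> \<Omega> \<noteq> {}"
  proof
    assume disj: "C \<inter> \<Omega> = {}"
    have "C \<noteq> {}" "C \<noteq> UNIV"
      using disj assms(2) C in_components_nonempty by auto
    then obtain x where x: "x \<in> frontier C"
      using frontier_eq_empty by blast
    have "frontier C \<subseteq> frontier (- (V - \<Omega>))"
      using C by (rule frontier_of_components_subset)
    also have "\<dots> \<subseteq> V - \<Omega>"
      using assms(4) compact_imp_closed by (metis frontier_complement frontier_subset_closed)
    finally have "x \<in> V" using x by blast
    moreover have "x \<in> closure C"
      using x by (simp add: frontier_def)
    ultimately obtain y where "y \<in> C" "y \<in> V"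
      using assms(3) by (meson disjoint_iff open_Int_closure_eq_empty)
    then show False
      using disj in_components_subset[OF C] by auto
  qed
qed auto

section \<open>The simply connected hull\<close>

text \<open>
  If a component of \<open>\<Omega> \<union> inside \<Omega>\<close> missed \<open>\<Omega>\<close>, its closure would be a connected subset of the complement
  of \<open>\<Omega>\<close> that joins an inside point to a boundary point in \<open>outside \<Omega>\<close>. What remains outside is a
  union of unbounded components, which is the criterion for simple connectedness.
\<close>

lemma Un_inside_simply_connected_domain:
  assumes "complex_domain \<Omega>"
  shows "complex_domain (- outside \<Omega>)" "simply_connected (- outside \<Omega>)"
proof -
  have \<Omega>: "\<Omega> \<noteq> {}" "open \<Omega>" "connected \<Omega>"
    using assms by (auto simp: complex_domain_def)
  have sub: "\<Omega> \<subseteq> - outside \<Omega>"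
    by (auto simp: outside_def)
  have op: "open (- outside \<Omega>)"
    using closed_outside_open[OF \<Omega>(2)] by auto
  have con: "connected (- outside \<Omega>)"
  proof (rule connected_if_components_meet[OF \<Omega>(3) sub])
    fix A assume A: "A \<in> components (- outside \<Omega>)"
    show "A \<inter> \<Omega> \<noteq> {}"
    proof
      assume disj: "A \<inter> \<Omega> = {}"
      have "A \<noteq> {}" "A \<noteq> UNIV"
        using disj \<Omega>(1) A in_components_nonempty by auto
      then obtain x a where x: "x \<in> frontier A" and a: "a \<in> A"
        using frontier_eq_empty by blast
      have "frontier A \<subseteq> frontier (- outside \<Omega>)"
        using A by (rule frontier_of_components_subset)
      also have "\<dots> \<subseteq> outside \<Omega>"
        using closed_outside_open[OF \<Omega>(2)] by (metis frontier_complement frontier_subset_closed)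
      finally have xo: "x \<in> outside \<Omega>" using x by blast
      have "connected (closure A)"
        using in_components_connected[OF A] connected_imp_connected_closure by blast
      moreover have "closure A \<subseteq> - \<Omega>"
        using disj \<Omega>(2) by (metis Int_commute disjoint_eq_subset_Compl open_Int_closure_eq_empty)
      moreover have "x \<in> closure A" "a \<in> closure A"
        using x a closure_subset by (auto simp: frontier_def)
      ultimately have "connected_component (- \<Omega>) x a"
        unfolding connected_component_def by blast
      then have "a \<in> outside \<Omega>"
        using xo outside_same_component by blast
      then show False
        using a in_components_subset[OF A] by auto
    qed
  qed
  show "complex_domain (- outside \<Omega>)"
    using op con sub \<Omega>(1) by (auto simp: complex_domain_def)
  have "\<not> bounded C" if C: "C \<in> components (- (- outside \<Omega>))" for C
  proof
    assume bd: "bounded C"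
    obtain x where x: "x \<in> outside \<Omega>" "C = connected_component_set (outside \<Omega>) x"
      using C by (auto simp: components_def)
    have "connected_component_set (- \<Omega>) x \<subseteq> outside \<Omega>"
      using x(1) outside_same_component by blast
    then have "connected_component_set (- \<Omega>) x \<subseteq> C"
      using x by (simp add: connected_component_maximal outside_def)
    then show False
      using x(1) bd bounded_subset by (auto simp: outside_def)
  qed
  then show "simply_connected (- outside \<Omega>)"
    using simply_connected_eq_unbounded_complement_components[OF op] con by blast
qed

lemma simply_connected_hull_eq:
  assumes "complex_domain \<Omega>"
  shows "simply_connected_hull \<Omega> = - outside \<Omega>"
proof
  have "\<Omega> \<subseteq> - outside \<Omega>"
    by (auto simp: outside_def)
  then show "simply_connected_hull \<Omega> \<subseteq> - outside \<Omega>"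
    unfolding simply_connected_hull_def
    using Un_inside_simply_connected_domain[OF assms] by blast
  have "outside \<Omega> \<supseteq> - G" if G: "complex_domain G" "simply_connected G" "\<Omega> \<subseteq> G" for G
  proof
    fix z assume z: "z \<in> - G"
    have "connected_component_set (- G) z \<in> components (- G)"
      using z by (auto simp: components_def)
    then have "\<not> bounded (connected_component_set (- G) z)"
      using G simply_connected_eq_unbounded_complement_components[of G] by (auto simp: complex_domain_def)
    moreover have "connected_component_set (- G) z \<subseteq> connected_component_set (- \<Omega>) z"
      using G(3) by (intro connected_component_mono) auto
    ultimately show "z \<in> outside \<Omega>"
      using z G(3) bounded_subset by (auto simp: outside_def)
  qed
  then show "- outside \<Omega> \<subseteq> simply_connected_hull \<Omega>"
    unfolding simply_connected_hull_def by blast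
qed

text \<open>
  An unbounded component accumulates at infinity, so adding the point at infinity keeps it connected.
  Conversely, a compact piece \<open>V - \<Omega>\<close> around an inside point and its complement separate that
  point from infinity.
\<close>

lemma component_of_infinity_eq:
  assumes "open \<Omega>"
  shows "component_of_infinity \<Omega> = insert None (Some ` outside \<Omega>)"
proof
  define Y where "Y = topspace riemann_sphere - Some ` \<Omega>"
  have None_Y: "None \<in> Y"
    by (auto simp: Y_def riemann_sphere_def)
  have comp: "connectedin riemann_sphere (component_of_infinity \<Omega>)" "component_of_infinity \<Omega> \<subseteq> Y"
    using connectedin_connected_component_of[of "subtopology riemann_sphere Y" None]
    by (auto simp: component_of_infinity_def Y_def connectedin_subtopology)
  have None_X: "None \<in> component_of_infinity \<Omega>"
    using None_Y unfolding component_of_infinity_def Y_def[symmetric]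
    by (auto simp: connected_component_of_refl riemann_sphere_def)
  show "component_of_infinity \<Omega> \<subseteq> insert None (Some ` outside \<Omega>)"
  proof
    fix p assume p: "p \<in> component_of_infinity \<Omega>"
    show "p \<in> insert None (Some ` outside \<Omega>)"
    proof (cases p)
      case (Some z)
      have z: "z \<notin> \<Omega>"
        using p comp(2) Some by (auto simp: Y_def)
      have "z \<notin> inside \<Omega>"
      proof
        assume "z \<in> inside \<Omega>"
        then obtain V where V: "open V" "z \<in> V" "compact (V - \<Omega>)"
          using compact_piece_of_complement[OF assms] by blast
        define E where "E = insert None (Some ` (- (V - \<Omega>)))"
        have "openin riemann_sphere E"
          unfolding E_def riemann_sphere_def openin_Alexandroff_compactification
          using V(3) compact_imp_closed by (auto simp: Compl_eq_Diff_UNIV)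
        moreover have "openin riemann_sphere (Some ` V)"
          using V(1) by (simp add: riemann_sphere_def)
        moreover have "component_of_infinity \<Omega> \<subseteq> E \<union> Some ` V"
          by (auto simp: E_def)
        moreover have "E \<inter> Some ` V \<inter> component_of_infinity \<Omega> = {}"
          using comp(2) by (auto simp: E_def Y_def)
        moreover have "E \<inter> component_of_infinity \<Omega> \<noteq> {}"
          using None_X by (auto simp: E_def)
        moreover have "Some ` V \<inter> component_of_infinity \<Omega> \<noteq> {}"
          using p Some V(2) by auto
        ultimately show False
          using comp(1) unfolding connectedin by blast
      qed
      then have "z \<in> outside \<Omega>"
        using z inside_Un_outside[of \<Omega>] by blast
      then show ?thesis
        using Some by simp
    qed auto
  qed
  show "insert None (Some ` outside \<Omega>) \<subseteq> component_of_infinity \<Omega>"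
  proof -
    have "Some z \<in> component_of_infinity \<Omega>" if z: "z \<in> outside \<Omega>" for z
    proof -
      let ?C = "connected_component_set (- \<Omega>) z"
      have C: "\<not> bounded ?C" "z \<in> ?C" "?C \<subseteq> - \<Omega>"
        using z connected_component_subset by (auto simp: outside_def)
      have conC: "connectedin riemann_sphere (Some ` ?C)"
        unfolding riemann_sphere_def
        by (rule connectedin_continuous_map_image[OF continuous_map_Some]) simp
      have "None \<in> riemann_sphere closure_of (Some ` ?C)"
        unfolding in_closure_of
      proof (intro conjI allI impI)
        fix T assume T: "None \<in> T \<and> openin riemann_sphere T"
        then obtain L where L: "compact L" "T = insert None (Some ` (- L))"
          by (auto simp: riemann_sphere_def openin_Alexandroff_compactification Compl_eq_Diff_UNIV)
        have "\<not> ?C \<subseteq> L"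
          using C(1) L(1) bounded_subset compact_imp_bounded by blast
        then show "\<exists>y. y \<in> Some ` ?C \<and> y \<in> T"
          using L(2) by auto
      qed (auto simp: riemann_sphere_def)
      then have "connectedin riemann_sphere (insert None (Some ` ?C))"
        using closure_of_subset[OF connectedin_subset_topspace[OF conC]]
        by (intro connectedin_intermediate_closure_of[OF conC]) auto
      moreover have "insert None (Some ` ?C) \<subseteq> Y"
        using C(3) None_Y by (auto simp: Y_def riemann_sphere_def)
      ultimately have "insert None (Some ` ?C) \<subseteq> component_of_infinity \<Omega>"
        unfolding component_of_infinity_def Y_def[symmetric]
        by (intro connected_component_of_maximal) (auto simp: connectedin_subtopology)
      then show ?thesis
        using C(2) by auto
    qed
    then show ?thesis
      using None_X by auto
  qed
qed

section \<open>Primitives\<close>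

text \<open>
  Integration by parts: with \<open>\<psi>' = f\<close>, the product \<open>P f\<close> is the derivative of \<open>P \<psi>\<close> minus
  \<open>P' \<psi>\<close>, where \<open>P'\<close> has smaller degree and \<open>\<psi>\<close> is a derivative of \<open>\<phi>\<close> of one order less.
\<close>

lemma poly_times_has_primitive:
  assumes "open S" "\<phi> holomorphic_on S" "degree P \<le> n"
    and "\<And>z. z \<in> S \<Longrightarrow> (deriv ^^ Suc n) \<phi> z = f z"
  shows "\<exists>h. \<forall>z\<in>S. (h has_field_derivative poly P z * f z) (at z)"
  using assms(3,4)
proof (induction n arbitrary: P f)
  case 0
  then obtain c where P: "P = [:c:]"
    by (auto elim: degree_eq_zeroE)
  have "((\<lambda>z. c * \<phi> z) has_field_derivative poly P z * f z) (at z)" if "z \<in> S" for z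
    using holomorphic_derivI[OF assms(2,1) that] 0(2)[OF that]
    by (auto simp: P intro!: derivative_eq_intros)
  then show ?case by blast
next
  case (Suc n)
  define \<psi> where "\<psi> = (deriv ^^ Suc n) \<phi>"
  have der: "(\<psi> has_field_derivative f z) (at z)" if "z \<in> S" for z
    using holomorphic_derivI[OF holomorphic_higher_deriv[OF assms(2,1), of "Suc n"] assms(1) that]
      Suc(3)[OF that] by (simp add: \<psi>_def)
  have "degree (pderiv P) \<le> n"
    using Suc(2) by (simp add: degree_pderiv)
  then obtain h where h: "\<And>z. z \<in> S \<Longrightarrow> (h has_field_derivative poly (pderiv P) z * \<psi> z) (at z)"
    using Suc(1)[of "pderiv P" \<psi>] by (auto simp: \<psi>_def)
  have "((\<lambda>z. poly P z * \<psi> z - h z) has_field_derivative poly P z * f z) (at z)" if "z \<in> S" for z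
    using der[OF that] h[OF that] by (auto intro!: derivative_eq_intros)
  then show ?case
    by (intro exI[of _ "\<lambda>z. poly P z * \<psi> z - h z"]) blast
qed

lemma polygonal_line_valid_path: "polygonal_line g \<Longrightarrow> valid_path g"
  by (induction rule: polygonal_line.induct) auto

lemma polygon_integrals_zero_if_primitives:
  assumes "open \<Omega>" "has_primitives_of_all_orders \<Omega> f" "closed_polygonal_line_in \<Omega> \<gamma>"
  shows "contour_integral \<gamma> (\<lambda>z. poly P z * f z) = 0"
proof -
  obtain \<phi> where "\<phi> holomorphic_on \<Omega>" "\<forall>z\<in>\<Omega>. (deriv ^^ Suc (degree P)) \<phi> z = f z"
    using assms(2) unfolding has_primitives_of_all_orders_def
    by (auto dest!: spec[of _ "Suc (degree P)"])
  then obtain h where h: "\<And>z. z \<in> \<Omega> \<Longrightarrow> (h has_field_derivative poly P z * f z) (at z)"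
    using poly_times_has_primitive[OF assms(1) _ order_refl, of \<phi> P f] by auto
  have "((\<lambda>z. poly P z * f z) has_contour_integral 0) \<gamma>"
    using assms(3) polygonal_line_valid_path
    by (intro Cauchy_theorem_primitive[where S = \<Omega> and f = h])
       (auto simp: closed_polygonal_line_in_def intro: has_field_derivative_at_within h)
  then show ?thesis
    by (rule contour_integral_unique)
qed

lemma iterated_primitive:
  assumes "open S"
    and prim: "\<And>F. F holomorphic_on S \<Longrightarrow> \<exists>h. \<forall>z. z \<in> S \<longrightarrow> (h has_field_derivative F z) (at z)"
    and "F holomorphic_on S"
  shows "\<exists>\<phi>. \<phi> holomorphic_on S \<and> (\<forall>z\<in>S. (deriv ^^ n) \<phi> z = F z)"
  using assms(3)
proof (induction n arbitrary: F)
  case (Suc n)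
  obtain h where h: "\<And>z. z \<in> S \<Longrightarrow> (h has_field_derivative F z) (at z)"
    using prim[OF Suc(2)] by blast
  then have "h holomorphic_on S"
    using assms(1) holomorphic_on_open by blast
  then obtain \<phi> where \<phi>: "\<phi> holomorphic_on S" "\<And>z. z \<in> S \<Longrightarrow> (deriv ^^ n) \<phi> z = h z"
    using Suc(1) by blast
  have "(deriv ^^ Suc n) \<phi> z = F z" if "z \<in> S" for z
  proof -
    have "\<forall>\<^sub>F w in nhds z. (deriv ^^ n) \<phi> w = h w"
      using assms(1) that \<phi>(2) eventually_nhds by blast
    then show ?thesis
      using deriv_cong_ev[of "(deriv ^^ n) \<phi>" h z z] DERIV_imp_deriv[OF h[OF that]] by simp
  qed
  then show ?case
    using \<phi>(1) by blast
qed auto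

lemma primitives_if_extension:
  assumes "complex_domain G" "simply_connected G" "open \<Omega>" "\<Omega> \<subseteq> G" "has_holomorphic_extension \<Omega> f G"
  shows "has_primitives_of_all_orders \<Omega> f"
  unfolding has_primitives_of_all_orders_def
proof (intro allI impI)
  fix n :: nat
  have G: "open G"
    using assms(1) by (simp add: complex_domain_def)
  obtain F where F: "F holomorphic_on G" "\<And>z. z \<in> \<Omega> \<Longrightarrow> F z = f z"
    using assms(5) by (auto simp: has_holomorphic_extension_def)
  have "\<exists>\<phi>. \<phi> holomorphic_on G \<and> (\<forall>z\<in>G. (deriv ^^ n) \<phi> z = F z)"
    using simply_connected_eq_global_primitive[OF G] assms(2) 
    by (intro iterated_primitive[OF G _ F(1)]) blast
  then obtain \<phi> where "\<phi> holomorphic_on G" "\<forall>z\<in>G. (deriv ^^ n) \<phi> z = F z"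
    by blast
  then show "\<exists>\<phi>. \<phi> holomorphic_on \<Omega> \<and> (\<forall>z\<in>\<Omega>. (deriv ^^ n) \<phi> z = f z)"
    using assms(4) F(2) by (intro exI[of _ \<phi>]) (auto intro: holomorphic_on_subset)
qed

lemma polygonal_line_reversepath: "polygonal_line g \<Longrightarrow> polygonal_line (reversepath g)"
proof (induction rule: polygonal_line.induct)
  case (join g h)
  then show ?case
    by (simp add: reversepath_joinpaths polygonal_line.join)
qed (auto intro: polygonal_line.segment)

lemma polygonally_connected:
  assumes "open S" "connected S" "a \<in> S" "b \<in> S"
  shows "\<exists>g. polygonal_line g \<and> path_image g \<subseteq> S \<and> pathstart g = a \<and> pathfinish g = b"
proof -
  define R where
    "R x y \<longleftrightarrow> (\<exists>g. polygonal_line g \<and> path_image g \<subseteq> S \<and> pathstart g = x \<and> pathfinish g = y)"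
    for x y
  have sym: "R y x" if xy: "R x y" for x y
  proof -
    from xy obtain g where "polygonal_line g" "path_image g \<subseteq> S" "pathstart g = x" "pathfinish g = y"
      unfolding R_def by blast
    then show ?thesis
      unfolding R_def using polygonal_line_reversepath by (intro exI[of _ "reversepath g"]) simp
  qed
  have trans: "R x z" if xy: "R x y" and yz: "R y z" for x y z
  proof -
    from xy obtain g where g: "polygonal_line g" "path_image g \<subseteq> S" "pathstart g = x" "pathfinish g = y"
      unfolding R_def by blast
    from yz obtain h where h: "polygonal_line h" "path_image h \<subseteq> S" "pathstart h = y" "pathfinish h = z"
      unfolding R_def by blast
    have "polygonal_line (g +++ h)"
      using g h by (intro polygonal_line.join) auto
    then show ?thesis
      unfolding R_def using g h by (intro exI[of _ "g +++ h"]) (simp add: path_image_join)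
  qed
  have local: "\<exists>T. openin (top_of_set S) T \<and> x \<in> T \<and> (\<forall>y\<in>T. R x y)" if "x \<in> S" for x
  proof -
    obtain r where r: "r > 0" "ball x r \<subseteq> S"
      using assms(1) \<open>x \<in> S\<close> openE by blast
    have "R x y" if "y \<in> ball x r" for y
    proof -
      have "closed_segment x y \<subseteq> ball x r"
        using \<open>y \<in> ball x r\<close> r(1) by (intro closed_segment_subset) auto
      then show ?thesis
        unfolding R_def using r(2) polygonal_line.segment by (intro exI[of _ "linepath x y"]) simp
    qed
    then show ?thesis
      using r by (intro exI[of _ "ball x r"]) (simp add: open_subset)
  qed
  have "R a b"
  proof (rule connected_equivalence_relation[OF assms(2-4)])
    show "R y x" if "R x y" for x y using that by (rule sym)
    show "R x z" if "R x y" "R y z" for x y z using that by (rule trans)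
  qed (rule local)
  then show ?thesis
    unfolding R_def .
qed

text \<open>
  The classical construction: the primitive at \<open>z\<close> is the integral along any polygonal line from a base
  point to \<open>z\<close>. On a disc it differs by a constant from a primitive supplied by convexity.
\<close>

lemma primitive_if_polygon_integrals_zero:
  assumes S: "open S" "connected S" and hol: "f holomorphic_on S"
    and zero: "\<And>\<gamma>. closed_polygonal_line_in S \<gamma> \<Longrightarrow> contour_integral \<gamma> f = 0"
  shows "\<exists>h. \<forall>z\<in>S. (h has_field_derivative f z) (at z)"
proof (cases "S = {}")
  case False
  then obtain a where a: "a \<in> S" by blast
  obtain g where g: "\<And>z. z \<in> S \<Longrightarrow> polygonal_line (g z)" "\<And>z. z \<in> S \<Longrightarrow> path_image (g z) \<subseteq> S"
      "\<And>z. z \<in> S \<Longrightarrow> pathstart (g z) = a" "\<And>z. z \<in> S \<Longrightarrow> pathfinish (g z) = z"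
    using polygonally_connected[OF S a] by metis
  define h where "h z = contour_integral (g z) f" for z
  have intble: "f contour_integrable_on p" if "polygonal_line p" "path_image p \<subseteq> S" for p
    using contour_integrable_holomorphic_simple[OF hol S(1) polygonal_line_valid_path] that by blast
  have diff: "h w - h z = contour_integral (linepath z w) f"
    if "z \<in> S" "w \<in> S" "closed_segment z w \<subseteq> S" for z w
  proof -
    \<comment> \<open>The loop goes out to \<open>z\<close>, crosses to \<open>w\<close>, and returns to the base point.\<close>
    let ?p = "g z +++ (linepath z w +++ reversepath (g w))"
    have poly: "polygonal_line (g z)" "polygonal_line (linepath z w)" "polygonal_line (reversepath (g w))"
      using that g polygonal_line_reversepath polygonal_line.segment by auto
    have join: "polygonal_line (linepath z w +++ reversepath (g w))"
      using poly that g by (intro polygonal_line.join) auto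
    have "closed_polygonal_line_in S ?p"
      unfolding closed_polygonal_line_in_def using that g poly
      by (auto intro!: polygonal_line.join simp: path_image_join)
    then have "contour_integral ?p f = 0"
      by (rule zero)
    moreover have "contour_integral ?p f = h z + (contour_integral (linepath z w) f - h w)"
      using that g poly join polygonal_line_valid_path
      by (simp add: contour_integral_join intble h_def contour_integral_reversepath path_image_join
            contour_integrable_join)
    ultimately show ?thesis
      by (simp add: algebra_simps)
  qed
  have "(h has_field_derivative f z) (at z)" if z: "z \<in> S" for z
  proof -
    obtain r where r: "r > 0" "ball z r \<subseteq> S"
      using S(1) z openE by blast
    have "continuous_on (ball z r) f"
      using hol r(2) holomorphic_on_imp_continuous_on holomorphic_on_subset by metis
    moreover have "f field_differentiable at x" if "x \<in> interior (ball z r) - {}" for x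
      using that r(2) holomorphic_on_imp_differentiable_at[OF hol S(1)] by auto
    ultimately obtain k where k: "\<And>x. x \<in> ball z r \<Longrightarrow> (k has_field_derivative f x) (at x within ball z r)"
      using holomorphic_convex_primitive[OF convex_ball finite.emptyI] by blast
    have eq: "k w - k z + h z = h w" if w: "w \<in> ball z r" for w
    proof -
      have seg: "closed_segment z w \<subseteq> ball z r"
        using w r(1) by (intro closed_segment_subset) auto
      then have "(f has_contour_integral (k w - k z)) (linepath z w)"
        using contour_integral_primitive[OF k, where g = "linepath z w"] by simp
      moreover have "h w - h z = contour_integral (linepath z w) f"
        using z w r seg by (intro diff) auto
      ultimately show ?thesis
        using contour_integral_unique by (metis diff_add_cancel)
    qed
    have zr: "z \<in> ball z r" using r by simp
    have "((\<lambda>w. k w - k z + h z) has_field_derivative f z) (at z)"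
      using k[OF zr] at_within_open[OF zr open_ball] by (auto intro!: derivative_eq_intros)
    then show ?thesis
      by (rule has_field_derivative_transform_within[OF _ r(1)]) (use eq in \<open>auto simp: dist_commute\<close>)
  qed
  then show ?thesis by blast
qed auto

section \<open>Cycles on a square grid\<close>

text \<open>
  A pair of integers names both a grid point and the square that has this point as its lower left
  corner. Edges are directed counterclockwise, so that a directed edge belongs to exactly one square, the one on
  its left.
\<close>

definition square_edges :: "int \<times> int \<Rightarrow> ((int \<times> int) \<times> (int \<times> int)) set" where
  "square_edges = (\<lambda>(i, j). {((i, j), (i + 1, j)), ((i + 1, j), (i + 1, j + 1)),
     ((i + 1, j + 1), (i, j + 1)), ((i, j + 1), (i, j))})"

definition boundary_edges :: "(int \<times> int) set \<Rightarrow> ((int \<times> int) \<times> (int \<times> int)) set" where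
  "boundary_edges S = {e \<in> \<Union> (square_edges ` S). prod.swap e \<notin> \<Union> (square_edges ` S)}"

lemma finite_square_edges: "finite (square_edges q)"
  by (cases q) (simp add: square_edges_def)

lemma finite_boundary_edges: "finite S \<Longrightarrow> finite (boundary_edges S)"
  by (rule finite_subset[of _ "\<Union> (square_edges ` S)"]) (auto simp: boundary_edges_def finite_square_edges)

lemma square_edges_disjoint: "p \<noteq> q \<Longrightarrow> square_edges p \<inter> square_edges q = {}"
  by (cases p; cases q) (auto simp: square_edges_def)

lemma reversed_edge_in_square:
  assumes "e \<in> square_edges q"
  shows "\<exists>p. prod.swap e \<in> square_edges p"
proof -
  obtain i j where q: "q = (i, j)" by (cases q)
  have "prod.swap e \<in> square_edges (i, j - 1) \<union> square_edges (i + 1, j) \<union>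
          square_edges (i, j + 1) \<union> square_edges (i - 1, j)"
    using assms by (auto simp: q square_edges_def)
  then show ?thesis by blast
qed

text \<open>
  Summing an antisymmetric quantity over the contours of all squares in \<open>S\<close>, the two opposite
  contributions of an edge between two squares cancel. The uses of this are \<open>L\<close> the contour
  integral along an edge, even of a function that is singular on inner edges, and \<open>L\<close> the increment of a
  function along an edge.
\<close>

lemma sum_square_edges_eq_boundary:
  fixes L :: "_ \<Rightarrow> complex"
  assumes "finite S" and anti: "\<And>e. L (prod.swap e) = - L e"
  shows "(\<Sum>q\<in>S. sum L (square_edges q)) = sum L (boundary_edges S)"
proof -
  define D where "D = \<Union> (square_edges ` S)"
  define I where "I = {e \<in> D. prod.swap e \<in> D}"
  have fin: "finite D"
    using assms(1) finite_square_edges by (auto simp: D_def)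
  have "sum L I = sum (\<lambda>e. L (prod.swap e)) I"
    by (rule sum.reindex_bij_witness[of _ prod.swap prod.swap]) (auto simp: I_def)
  also have "\<dots> = - sum L I"
    by (simp add: anti sum_negf)
  finally have "sum L I = 0"
    by simp
  moreover have "D = boundary_edges S \<union> I" "boundary_edges S \<inter> I = {}"
    by (auto simp: boundary_edges_def I_def D_def)
  then have "sum L D = sum L (boundary_edges S) + sum L I"
    using fin by (metis finite_Un sum.union_disjoint)
  moreover have "sum L D = (\<Sum>q\<in>S. sum L (square_edges q))"
    unfolding D_def using assms(1) finite_square_edges square_edges_disjoint
    by (intro sum.UNION_disjoint) auto
  ultimately show ?thesis by simp
qed

definition grid_point :: "real \<Rightarrow> int \<times> int \<Rightarrow> complex" where
  "grid_point d = (\<lambda>(i, j). Complex (d * of_int i) (d * of_int j))"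

definition cell :: "real \<Rightarrow> int \<times> int \<Rightarrow> complex set" where
  "cell d = (\<lambda>(i, j). cbox (grid_point d (i, j)) (grid_point d (i + 1, j + 1)))"

definition edge_path :: "real \<Rightarrow> (int \<times> int) \<times> (int \<times> int) \<Rightarrow> real \<Rightarrow> complex" where
  "edge_path d e = linepath (grid_point d (fst e)) (grid_point d (snd e))"

definition boundary_integral :: "real \<Rightarrow> (int \<times> int) set \<Rightarrow> (complex \<Rightarrow> complex) \<Rightarrow> complex" where
  "boundary_integral d S h = (\<Sum>e\<in>boundary_edges S. contour_integral (edge_path d e) h)"

definition cells_meeting :: "real \<Rightarrow> complex set \<Rightarrow> (int \<times> int) set" where
  "cells_meeting d K = {q. cell d q \<inter> K \<noteq> {}}"

lemma mem_cell:
  "z \<in> cell d (i, j) \<longleftrightarrow> d * i \<le> Re z \<and> Re z \<le> d * (i + 1) \<and> d * j \<le> Im z \<and> Im z \<le> d * (j + 1)"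
  by (auto simp: cell_def grid_point_def in_cbox_complex_iff)

lemma dist_cell:
  assumes "z \<in> cell d q" "w \<in> cell d q"
  shows "dist z w \<le> 2 * d"
proof -
  obtain i j where q: "q = (i, j)" by (cases q)
  have "\<bar>Re (z - w)\<bar> \<le> d" "\<bar>Im (z - w)\<bar> \<le> d"
    using assms by (auto simp: q mem_cell abs_le_iff algebra_simps)
  then show ?thesis
    using cmod_le[of "z - w"] by (simp add: dist_norm)
qed

lemma infdist_cell:
  assumes "q \<in> cells_meeting d K" "z \<in> cell d q"
  shows "\<exists>x\<in>K. dist z x \<le> 2 * d"
  using assms dist_cell unfolding cells_meeting_def by blast

lemma finite_cells_meeting:
  assumes "bounded K" "d > 0"
  shows "finite (cells_meeting d K)"
proof -
  obtain B where B: "\<And>x. x \<in> K \<Longrightarrow> norm x \<le> B"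
    using assms(1) bounded_iff by blast
  have mult: "i \<in> {\<lfloor>- B / d\<rfloor> - 1..\<lceil>B / d\<rceil>}" if "d * of_int i \<le> x" "x \<le> d * (of_int i + 1)" "\<bar>x\<bar> \<le> B"
    for i :: int and x
  proof -
    have "of_int i \<le> B / d" "- B / d \<le> of_int i + 1"
      using that assms(2) by (auto simp: field_simps)
    then show ?thesis
      by (auto simp: ceiling_le_iff) linarith+
  qed
  have "cells_meeting d K \<subseteq> {\<lfloor>- B / d\<rfloor> - 1..\<lceil>B / d\<rceil>} \<times> {\<lfloor>- B / d\<rfloor> - 1..\<lceil>B / d\<rceil>}"
  proof
    fix q assume "q \<in> cells_meeting d K"
    then obtain i j x where q: "q = (i, j)" and x: "x \<in> cell d (i, j)" "x \<in> K"
      unfolding cells_meeting_def by (cases q) auto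
    have "\<bar>Re x\<bar> \<le> B" "\<bar>Im x\<bar> \<le> B"
      using B[OF x(2)] abs_Re_le_cmod abs_Im_le_cmod order_trans by blast+
    moreover have "d * of_int i \<le> Re x" "Re x \<le> d * (of_int i + 1)"
      "d * of_int j \<le> Im x" "Im x \<le> d * (of_int j + 1)"
      using x(1) unfolding mem_cell of_int_add of_int_1 by blast+
    ultimately show "q \<in> {\<lfloor>- B / d\<rfloor> - 1..\<lceil>B / d\<rceil>} \<times> {\<lfloor>- B / d\<rfloor> - 1..\<lceil>B / d\<rceil>}"
      unfolding q using mult by (intro SigmaI)
  qed
  then show ?thesis
    by (rule finite_subset) simp
qed

lemma path_image_edge_path: "path_image (edge_path d e) = closed_segment (grid_point d (fst e)) (grid_point d (snd e))"
  by (simp add: edge_path_def)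

lemma edge_subset_cell:
  assumes "e \<in> square_edges q" "d > 0"
  shows "path_image (edge_path d e) \<subseteq> cell d q"
proof -
  obtain i j where q: "q = (i, j)" by (cases q)
  have "convex (cell d q)"
    by (simp add: cell_def q)
  moreover have "grid_point d (fst e) \<in> cell d q" "grid_point d (snd e) \<in> cell d q"
    using assms by (auto simp: q square_edges_def mem_cell grid_point_def)
  ultimately show ?thesis
    by (simp add: path_image_edge_path closed_segment_subset)
qed

text \<open>
  The square on the other side of a boundary edge was not selected, so it does not meet \<open>K\<close>.
\<close>

lemma boundary_edge_avoids:
  assumes "e \<in> boundary_edges (cells_meeting d K)" "d > 0"
  shows "path_image (edge_path d e) \<inter> K = {}"
proof -
  obtain p where p: "prod.swap e \<in> square_edges p" 
    using assms(1) reversed_edge_in_square unfolding boundary_edges_def by blast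
  then have "p \<notin> cells_meeting d K"
    using assms(1) by (auto simp: boundary_edges_def)
  moreover have "path_image (edge_path d e) = path_image (edge_path d (prod.swap e))"
    by (simp add: path_image_edge_path closed_segment_commute)
  ultimately show ?thesis
    using edge_subset_cell[OF p assms(2)] by (auto simp: cells_meeting_def)
qed

lemma boundary_edge_near:
  assumes "e \<in> boundary_edges (cells_meeting d K)" "d > 0" "z \<in> path_image (edge_path d e)"
  shows "\<exists>x\<in>K. dist z x \<le> 2 * d"
proof -
  obtain q where "q \<in> cells_meeting d K" "e \<in> square_edges q"
    using assms(1) by (auto simp: boundary_edges_def)
  then show ?thesis
    using infdist_cell edge_subset_cell assms(2,3) by blast
qed

lemma contour_integral_edge_swap:
  "contour_integral (edge_path d (prod.swap e)) h = - contour_integral (edge_path d e) h"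
  using contour_integral_reversepath[of "edge_path d e" h] by (simp add: edge_path_def)

lemma boundary_integral_eq_sum_squares:
  "finite S \<Longrightarrow> boundary_integral d S h = (\<Sum>q\<in>S. \<Sum>e\<in>square_edges q. contour_integral (edge_path d e) h)"
  unfolding boundary_integral_def
  by (rule sum_square_edges_eq_boundary[symmetric]) (auto simp: contour_integral_edge_swap)

lemma sum_square_edges:
  fixes L :: "_ \<Rightarrow> complex"
  shows "sum L (square_edges (i, j)) =
    L ((i, j), (i + 1, j)) + L ((i + 1, j), (i + 1, j + 1)) + L ((i + 1, j + 1), (i, j + 1)) + L ((i, j + 1), (i, j))"
  by (simp add: square_edges_def)

lemma square_integral_eq_rectpath:
  assumes "d > 0" "continuous_on (\<Union>e\<in>square_edges (i, j). path_image (edge_path d e)) h"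
  shows "(\<Sum>e\<in>square_edges (i, j). contour_integral (edge_path d e) h) =
    contour_integral (rectpath (grid_point d (i, j)) (grid_point d (i + 1, j + 1))) h"
proof -
  have int: "h contour_integrable_on edge_path d e" if "e \<in> square_edges (i, j)" for e
    unfolding edge_path_def
    by (rule contour_integrable_continuous_linepath, rule continuous_on_subset[OF assms(2)])
       (use that path_image_edge_path in blast)
  have "h contour_integrable_on edge_path d ((i, j), (i + 1, j))"
    "h contour_integrable_on edge_path d ((i + 1, j), (i + 1, j + 1))"
    "h contour_integrable_on edge_path d ((i + 1, j + 1), (i, j + 1))"
    "h contour_integrable_on edge_path d ((i, j + 1), (i, j))"
    by (auto intro!: int simp: square_edges_def)
  then show ?thesis
    unfolding sum_square_edges
    by (simp add: rectpath_def Let_def edge_path_def grid_point_def contour_integrable_join contour_integral_join)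
qed

lemma edges_eq_rectpath_image:
  "(\<Union>e\<in>square_edges (i, j). path_image (edge_path d e)) =
    path_image (rectpath (grid_point d (i, j)) (grid_point d (i + 1, j + 1)))"
  by (simp add: rectpath_def Let_def square_edges_def edge_path_def grid_point_def path_image_join Un_assoc)

lemma square_Cauchy_integral:
  assumes d: "d > 0" and f: "f holomorphic_on cell d q"
    and z: "z \<in> interior (cell d q) \<or> z \<notin> cell d q"
  shows "(\<Sum>e\<in>square_edges q. contour_integral (edge_path d e) (\<lambda>w. f w / (w - z))) =
    (if z \<in> cell d q then 2 * of_real pi * \<i> * f z else 0)"
proof -
  obtain i j where q: "q = (i, j)" by (cases q)
  define a b where "a = grid_point d (i, j)" and "b = grid_point d (i + 1, j + 1)"
  have ab: "Re a \<le> Re b" "Im a \<le> Im b"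
    using d by (auto simp: a_def b_def grid_point_def)
  have cell: "cell d q = cbox a b" "interior (cell d q) = box a b"
    by (auto simp: q cell_def a_def b_def)
  have img: "path_image (rectpath a b) \<subseteq> cell d q - {z}"
    using z path_image_rectpath_cbox_minus_box[OF ab] cell by auto
  have "continuous_on (path_image (rectpath a b)) (\<lambda>w. f w / (w - z))"
    using img holomorphic_on_imp_continuous_on[OF f]
    by (intro continuous_intros) (auto intro: continuous_on_subset)
  then have eq: "(\<Sum>e\<in>square_edges q. contour_integral (edge_path d e) (\<lambda>w. f w / (w - z))) =
      contour_integral (rectpath a b) (\<lambda>w. f w / (w - z))"
    unfolding q a_def b_def by (intro square_integral_eq_rectpath[OF d]) (simp only: edges_eq_rectpath_image)
  have conv: "convex (cell d q)"
    by (simp add: cell)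
  show ?thesis
  proof (cases "z \<in> cell d q")
    case True
    then have zi: "z \<in> interior (cell d q)" using z by blast
    have "((\<lambda>w. f w / (w - z)) has_contour_integral
        complex_of_real (2 * pi) * \<i> * winding_number (rectpath a b) z * f z) (rectpath a b)"
      by (rule Cauchy_integral_formula_convex_simple[OF conv f zi _ img]) auto
    moreover have "winding_number (rectpath a b) z = 1"
      using zi by (intro winding_number_rectpath) (simp add: cell)
    ultimately show ?thesis
      using True contour_integral_unique eq by auto
  next
    case False
    have "(\<lambda>w. f w / (w - z)) holomorphic_on cell d q"
      using f False by (intro holomorphic_intros) auto
    then have "((\<lambda>w. f w / (w - z)) has_contour_integral 0) (rectpath a b)"
      using conv img by (intro Cauchy_theorem_convex_simple[where S = "cell d q"]) auto
    then show ?thesis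
      using False contour_integral_unique eq by auto
  qed
qed

text \<open>
  This is where the boundary edges act as a cycle: the increments of \<open>h\<close> along the four sides of each
  square add up to zero, hence so do the increments along the boundary. Values of \<open>h\<close> at vertices off the
  boundary are arbitrary and cancel.
\<close>

lemma boundary_integral_derivative:
  assumes "finite S" "\<And>e z. e \<in> boundary_edges S \<Longrightarrow> z \<in> path_image (edge_path d e) \<Longrightarrow> (h has_field_derivative g z) (at z)"
  shows "boundary_integral d S g = 0"
proof -
  let ?L = "\<lambda>e. h (grid_point d (snd e)) - h (grid_point d (fst e))"
  have "boundary_integral d S g = sum ?L (boundary_edges S)"
    unfolding boundary_integral_def
  proof (rule sum.cong[OF refl])
    fix e assume e: "e \<in> boundary_edges S"
    have "(g has_contour_integral (h (pathfinish (edge_path d e)) - h (pathstart (edge_path d e)))) (edge_path d e)"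
      by (rule contour_integral_primitive[where S = "path_image (edge_path d e)"])
         (use assms(2)[OF e] in \<open>auto simp: edge_path_def intro: has_field_derivative_at_within\<close>)
    then show "contour_integral (edge_path d e) g = ?L e"
      by (simp add: contour_integral_unique edge_path_def)
  qed
  also have "\<dots> = (\<Sum>q\<in>S. sum ?L (square_edges q))"
    using assms(1) by (intro sum_square_edges_eq_boundary[symmetric]) auto
  also have "\<dots> = 0"
    by (rule sum.neutral) (auto simp: sum_square_edges)
  finally show ?thesis .
qed

section \<open>Cauchy transforms along segments\<close>

lemma Cauchy_transform_holomorphic:
  assumes "continuous_on (closed_segment a b) f"
  shows "(\<lambda>z. contour_integral (linepath a b) (\<lambda>w. f w / (w - z))) holomorphic_on - closed_segment a b"
proof (rule holomorphic_on_open[THEN iffD2], safe)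
  fix z assume z: "z \<notin> closed_segment a b"
  have int: "((\<lambda>u. f u / (u - w) ^ 1) has_contour_integral
       contour_integral (linepath a b) (\<lambda>u. f u / (u - w))) (linepath a b)" if "w \<notin> closed_segment a b" for w
  proof -
    have "continuous_on (closed_segment a b) (\<lambda>u. f u / (u - w))"
      using that by (intro continuous_intros assms) auto
    then show ?thesis
      by (simp add: contour_integrable_continuous_linepath has_contour_integral_integral)
  qed
  have "((\<lambda>z. contour_integral (linepath a b) (\<lambda>w. f w / (w - z))) has_field_derivative
      of_nat 1 * contour_integral (linepath a b) (\<lambda>u. f u / (u - z) ^ Suc 1)) (at z)"
    by (rule Cauchy_next_derivative(2)[where S = UNIV and B = "norm (b - a)"])
       (use z int assms in \<open>auto simp: vector_derivative_linepath_at\<close>)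
  then show "\<exists>f'. ((\<lambda>z. contour_integral (linepath a b) (\<lambda>w. f w / (w - z))) has_field_derivative f') (at z)"
    by blast
qed auto

text \<open>
  Vanishing of the Cauchy transform outside a disc that contains the segments. From
  \<open>w / (w - z) = 1 + z / (w - z)\<close> and the vanishing moments, the transform of \<open>w\<^sup>n f\<close> is \<open>z\<^sup>n\<close> times the
  transform of \<open>f\<close>. But it is at most of order \<open>R\<^sup>n\<close>, which for \<open>\<bar>z\<bar> > R\<close> forces the transform of \<open>f\<close> to be zero.
\<close>

lemma Cauchy_transform_zero_if_moments_zero:
  fixes a b :: "'i \<Rightarrow> complex"
  assumes "finite E"
    and cont: "\<And>e. e \<in> E \<Longrightarrow> continuous_on (closed_segment (a e) (b e)) f"
    and mom: "\<And>n. (\<Sum>e\<in>E. contour_integral (linepath (a e) (b e)) (\<lambda>w. w ^ n * f w)) = 0"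
    and R: "\<And>e w. e \<in> E \<Longrightarrow> w \<in> closed_segment (a e) (b e) \<Longrightarrow> norm w \<le> R"
    and z: "norm z > R" and "R \<ge> 0"
  shows "(\<Sum>e\<in>E. contour_integral (linepath (a e) (b e)) (\<lambda>w. f w / (w - z))) = 0"
proof -
  define B where "B n = (\<Sum>e\<in>E. contour_integral (linepath (a e) (b e)) (\<lambda>w. w ^ n * f w / (w - z)))" for n
  have wz: "w \<noteq> z" if "e \<in> E" "w \<in> closed_segment (a e) (b e)" for e w
    using R[OF that] z by auto
  have int: "(\<lambda>w. w ^ n * f w / (w - z)) contour_integrable_on linepath (a e) (b e)"
     "(\<lambda>w. w ^ n * f w) contour_integrable_on linepath (a e) (b e)" if "e \<in> E" for e n
    using wz[OF that] 
    by (auto intro!: contour_integrable_continuous_linepath continuous_intros cont[OF that])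
  have step: "B (Suc n) = z * B n" for n
  proof -
    have "B (Suc n) = (\<Sum>e\<in>E. z * contour_integral (linepath (a e) (b e)) (\<lambda>w. w ^ n * f w / (w - z)) + 
       contour_integral (linepath (a e) (b e)) (\<lambda>w. w ^ n * f w))"
      unfolding B_def
    proof (rule sum.cong[OF refl])
      fix e assume e: "e \<in> E"
      have "((\<lambda>w. z * (w ^ n * f w / (w - z)) + w ^ n * f w) has_contour_integral
           z * contour_integral (linepath (a e) (b e)) (\<lambda>w. w ^ n * f w / (w - z)) +
           contour_integral (linepath (a e) (b e)) (\<lambda>w. w ^ n * f w)) (linepath (a e) (b e))"
        by (rule has_contour_integral_add[OF has_contour_integral_lmul])
           (rule has_contour_integral_integral[OF int(1)[OF e]] has_contour_integral_integral[OF int(2)[OF e]])+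
      then have "((\<lambda>w. w ^ Suc n * f w / (w - z)) has_contour_integral
           z * contour_integral (linepath (a e) (b e)) (\<lambda>w. w ^ n * f w / (w - z)) +
           contour_integral (linepath (a e) (b e)) (\<lambda>w. w ^ n * f w)) (linepath (a e) (b e))"
      proof (rule has_contour_integral_eq)
        fix w assume "w \<in> path_image (linepath (a e) (b e))"
        then have "w - z \<noteq> 0" using wz[OF e] by auto
        then show "z * (w ^ n * f w / (w - z)) + w ^ n * f w = w ^ Suc n * f w / (w - z)"
          by (simp add: field_simps)
      qed
      then show "contour_integral (linepath (a e) (b e)) (\<lambda>w. w ^ Suc n * f w / (w - z)) =
         z * contour_integral (linepath (a e) (b e)) (\<lambda>w. w ^ n * f w / (w - z)) +
         contour_integral (linepath (a e) (b e)) (\<lambda>w. w ^ n * f w)"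
        by (rule contour_integral_unique)
    qed
    also have "\<dots> = z * B n"
      by (simp add: sum.distrib mom B_def sum_distrib_left)
    finally show ?thesis .
  qed
  have power: "B n = z ^ n * B 0" for n
    by (induction n) (simp_all add: step)
  have "\<exists>C\<ge>0. \<forall>w\<in>closed_segment (a e) (b e). norm (f w / (w - z)) \<le> C" if e: "e \<in> E" for e
  proof -
    have "compact ((\<lambda>w. f w / (w - z)) ` closed_segment (a e) (b e))"
      using wz[OF e] by (intro compact_continuous_image continuous_intros cont[OF e]) auto
    then obtain C where "\<forall>x\<in>(\<lambda>w. f w / (w - z)) ` closed_segment (a e) (b e). norm x \<le> C"
      using compact_imp_bounded bounded_iff by blast
    then show ?thesis
      by (intro exI[of _ "max C 0"]) (auto simp: le_max_iff_disj)
  qed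
  then obtain C where C: "\<And>e. e \<in> E \<Longrightarrow> C e \<ge> 0"
     "\<And>e w. e \<in> E \<Longrightarrow> w \<in> closed_segment (a e) (b e) \<Longrightarrow> norm (f w / (w - z)) \<le> C e"
    by metis
  define M where "M = (\<Sum>e\<in>E. C e * norm (b e - a e))"
  have bound: "norm (B n) \<le> R ^ n * M" for n
  proof -
    have "norm (B n) \<le> (\<Sum>e\<in>E. R ^ n * C e * norm (b e - a e))"
      unfolding B_def
    proof (rule sum_norm_le)
      fix e assume e: "e \<in> E"
      show "norm (contour_integral (linepath (a e) (b e)) (\<lambda>w. w ^ n * f w / (w - z)))
           \<le> R ^ n * C e * norm (b e - a e)"
      proof (rule contour_integral_bound_linepath[OF int(1)[OF e]])
        fix w assume w: "w \<in> closed_segment (a e) (b e)"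
        have "norm (w ^ n * (f w / (w - z))) \<le> R ^ n * C e"
          unfolding norm_mult norm_power using R[OF e w] C(2)[OF e w] assms(6)
          by (intro mult_mono power_mono) auto
        then show "norm (w ^ n * f w / (w - z)) \<le> R ^ n * C e"
          by simp
      qed (use C(1)[OF e] assms(6) in simp)
    qed
    then show ?thesis
      by (simp add: M_def sum_distrib_left mult.assoc)
  qed
  have z0: "norm z > 0" using z assms(6) by linarith
  have "norm (B 0) \<le> (R / norm z) ^ n * M" for n
    using bound[of n] z0 unfolding power[of n] by (simp add: norm_mult norm_power field_simps)
  moreover have "(\<lambda>n. (R / norm z) ^ n * M) \<longlonglongrightarrow> 0 * M"
    using z z0 assms(6) by (intro tendsto_intros LIMSEQ_realpow_zero) auto
  ultimately have "norm (B 0) \<le> 0"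
    by (intro LIMSEQ_le_const[of "\<lambda>n. (R / norm z) ^ n * M"]) auto
  then show ?thesis
    by (simp add: B_def)
qed

text \<open>
  Points off the grid lines are dense: move \<open>z\<close> diagonally by a small amount that avoids countably many
  values. This lets Cauchy's formula be proved off the grid lines only and extended by continuity.
\<close>

lemma interior_cell_point:
  assumes "open U" "z \<in> U" "d > 0"
  shows "\<exists>w\<in>U. \<exists>q. w \<in> interior (cell d q) \<and> (\<forall>p. w \<in> cell d p \<longrightarrow> p = q)"
proof -
  obtain r where r: "r > 0" "ball z r \<subseteq> U"
    using assms(1,2) openE by blast
  let ?C = "range (\<lambda>i::int. d * i - Re z) \<union> range (\<lambda>i::int. d * i - Im z)"
  have "uncountable ({0<..<r / 2} - ?C)"
    using r(1) by (intro uncountable_minus_countable) (auto simp: uncountable_open_interval)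
  then have "{0<..<r / 2} - ?C \<noteq> {}"
    by (metis countable_empty)
  then obtain t where "t \<in> {0<..<r / 2} - ?C"
    by blast
  then have t: "t \<in> {0<..<r / 2}" "t \<notin> ?C"
    by blast+
  define w where "w = z + Complex t t"
  define i j where "i = \<lfloor>Re w / d\<rfloor>" and "j = \<lfloor>Im w / d\<rfloor>"
  have "norm (Complex t t) \<le> 2 * t"
    using cmod_le[of "Complex t t"] t(1) by simp
  then have "w \<in> ball z r"
    using t(1) by (simp add: w_def dist_norm)
  then have wU: "w \<in> U"
    using r(2) by blast
  have off: "Re w \<noteq> d * of_int k" "Im w \<noteq> d * of_int k" for k :: int
  proof -
    have "t \<noteq> d * of_int k - Re z" "t \<noteq> d * of_int k - Im z"
      using t(2) by blast+
    then show "Re w \<noteq> d * of_int k" "Im w \<noteq> d * of_int k"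
      by (auto simp: w_def)
  qed
  have "i \<le> Re w / d" "Re w / d < i + 1" "j \<le> Im w / d" "Im w / d < j + 1"
    by (simp_all add: i_def j_def)
  then have bounds: "d * i \<le> Re w" "Re w < d * (i + 1)" "d * j \<le> Im w" "Im w < d * (j + 1)"
    using assms(3) by (simp_all add: pos_le_divide_eq pos_divide_less_eq mult.commute)
  have inter: "w \<in> interior (cell d (i, j))"
    using bounds off[of i] off[of j] by (auto simp: cell_def grid_point_def in_box_complex_iff)
  have unique: "p = (i, j)" if "w \<in> cell d p" for p
  proof -
    obtain k l where p: "p = (k, l)" by (cases p)
    have "d * k \<le> Re w" "Re w < d * (k + 1)" "d * l \<le> Im w" "Im w < d * (l + 1)"
      using that off[of "k + 1"] off[of "l + 1"] unfolding p mem_cell by auto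
    then have "\<lfloor>Re w / d\<rfloor> = k" "\<lfloor>Im w / d\<rfloor> = l"
      using assms(3) by (auto intro!: floor_unique simp: field_simps)
    then show ?thesis by (simp add: p i_def j_def)
  qed
  show ?thesis
    using unique by (intro bexI[OF _ wU] exI[of _ "(i, j)"] conjI inter) simp
qed

lemma boundary_integral_Cauchy_holomorphic:
  assumes "\<And>e. e \<in> boundary_edges S \<Longrightarrow> continuous_on (path_image (edge_path d e)) f"
    and "\<And>e. e \<in> boundary_edges S \<Longrightarrow> path_image (edge_path d e) \<inter> U = {}"
  shows "(\<lambda>z. boundary_integral d S (\<lambda>w. f w / (w - z))) holomorphic_on U"
  unfolding boundary_integral_def
proof (rule holomorphic_on_sum)
  fix e assume e: "e \<in> boundary_edges S"
  show "(\<lambda>z. contour_integral (edge_path d e) (\<lambda>w. f w / (w - z))) holomorphic_on U"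
    using assms(1)[OF e] assms(2)[OF e] unfolding edge_path_def path_image_linepath
    by (intro holomorphic_on_subset[OF Cauchy_transform_holomorphic]) auto
qed

text \<open>
  In the difference of two such cycles only the squares in \<open>S - T\<close> count, and of these only
  the one around \<open>z\<close> contributes.
\<close>

lemma boundary_integral_Cauchy_difference:
  assumes "finite S" "T \<subseteq> S" "d > 0"
    and f: "\<And>q. q \<in> S - T \<Longrightarrow> f holomorphic_on cell d q"
    and z: "z \<in> interior (cell d q)" "q \<in> S - T" "\<And>p. z \<in> cell d p \<Longrightarrow> p = q"
  shows "boundary_integral d S (\<lambda>w. f w / (w - z)) =
    boundary_integral d T (\<lambda>w. f w / (w - z)) + 2 * of_real pi * \<i> * f z"
proof -
  let ?I = "\<lambda>q. \<Sum>e\<in>square_edges q. contour_integral (edge_path d e) (\<lambda>w. f w / (w - z))"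
  have "sum ?I S = sum ?I T + sum ?I (S - T)"
    using sum.subset_diff[OF assms(2,1), of ?I] by (simp only: add.commute)
  moreover have "sum ?I (S - T) = (\<Sum>p\<in>S - T. if p = q then 2 * of_real pi * \<i> * f z else 0)"
  proof (rule sum.cong[OF refl])
    fix p assume p: "p \<in> S - T"
    have "z \<in> cell d q"
      using z(1) interior_subset by (rule subsetD[rotated])
    then have "z \<in> cell d p \<longleftrightarrow> p = q"
      using z(3) by metis
    then show "?I p = (if p = q then 2 * of_real pi * \<i> * f z else 0)"
      using square_Cauchy_integral[OF assms(3) f[OF p], of z] z(1) by auto
  qed
  moreover have "\<dots> = 2 * of_real pi * \<i> * f z"
    using assms(1) z(2) by (simp add: sum.delta)
  moreover have "finite T"
    using assms(1,2) by (rule rev_finite_subset)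
  ultimately show ?thesis
    using assms(1) by (simp add: boundary_integral_eq_sum_squares)
qed

section \<open>Extension across a compact piece of the complement\<close>

text \<open>
  The grid has mesh \<open>d\<close>, and a square that meets a set stays within distance \<open>2 d\<close> of it. The inner cycle
  bounds the squares \<open>T\<close> that meet \<open>K\<close>, the outer one the squares \<open>S\<close> that meet the closed \<open>3 d\<close>-neighbourhood \<open>K1\<close>;
  all of them lie within distance \<open>5 d < 6 d\<close> of \<open>K\<close>, hence in \<open>V\<close>. Then \<open>A\<close> is holomorphic on the
  open \<open>3 d\<close>-neighbourhood \<open>U\<close> and \<open>B\<close> on the set \<open>W\<close> of points farther than \<open>2 d\<close>. These two sets
  cover the plane, and Cauchy's formula relates \<open>A\<close> and \<open>B\<close> on their overlap.
\<close>

lemma extension_across_compact: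
  assumes "open \<Omega>" and f: "f holomorphic_on \<Omega>" and "open V"
    and K: "compact (V - \<Omega>)" "V - \<Omega> \<noteq> {}" "connected (- (V - \<Omega>))"
    and mom: "\<And>n. \<exists>h. \<forall>z\<in>\<Omega>. (h has_field_derivative z ^ n * f z) (at z)"
  shows "\<exists>U F. open U \<and> V - \<Omega> \<subseteq> U \<and> U \<subseteq> V \<and> F holomorphic_on U \<and> (\<forall>z\<in>U \<inter> \<Omega>. F z = f z)"
proof -
  define K where "K = V - \<Omega>"
  have K: "compact K" "K \<noteq> {}" "connected (- K)"
    using assms by (simp_all add: K_def)
  obtain r where r: "r > 0" "(\<Union>x\<in>K. ball x r) \<subseteq> V"
    using compact_subset_open_imp_ball_epsilon_subset[OF K(1) assms(3)] K_def by blast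
  define d where "d = r / 6"
  have d: "d > 0" "r = 6 * d" using r(1) by (auto simp: d_def)
  have near_V: "z \<in> V" if "infdist z K < 6 * d" for z
  proof -
    obtain x where "x \<in> K" "infdist z K = dist z x"
      using infdist_attains_inf[of K z] K compact_imp_closed by blast
    then have "x \<in> K" "z \<in> ball x r"
      using that d(2) by (auto simp: dist_commute)
    then show ?thesis
      using r(2) by blast
  qed
  define K1 where "K1 = {z. infdist z K \<le> 3 * d}"
  have K1: "compact K1" "K \<subseteq> K1"
    using compact_infdist_le[OF K(2,1)] d(1) by (auto simp: K1_def)
  define S where "S = cells_meeting d K1"
  define T where "T = cells_meeting d K"
  have fin: "finite S" "finite T"
    using finite_cells_meeting d(1) K K1 compact_imp_bounded by (auto simp: S_def T_def)
  have TS: "T \<subseteq> S"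
    using K1(2) by (auto simp: S_def T_def cells_meeting_def)
  define U where "U = {z. infdist z K < 3 * d}"
  define W where "W = {z. infdist z K > 2 * d}"
  have openUW: "open U" "open W"
    unfolding U_def W_def by (intro open_Collect_less continuous_intros)+
  have T_near: "infdist z K \<le> 2 * d" if "\<exists>x\<in>K. dist z x \<le> 2 * d" for z
    using that infdist_le order_trans by blast
  have S_near: "infdist z K < 6 * d" if "\<exists>x\<in>K1. dist z x \<le> 2 * d" for z
  proof -
    from that obtain x where x: "x \<in> K1" "dist z x \<le> 2 * d" by blast
    have "infdist z K \<le> infdist x K + dist z x"
      by (rule infdist_triangle)
    then show ?thesis
      using x d(1) by (simp add: K1_def)
  qed
  have S_edge: "path_image (edge_path d e) \<subseteq> \<Omega>" "path_image (edge_path d e) \<inter> U = {}" if "e \<in> boundary_edges S" for e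
  proof -
    have disj: "path_image (edge_path d e) \<inter> K1 = {}"
      using boundary_edge_avoids that d(1) by (simp add: S_def)
    then show "path_image (edge_path d e) \<inter> U = {}"
      by (auto simp: U_def K1_def)
    have "path_image (edge_path d e) \<subseteq> V"
      using boundary_edge_near that d(1) S_near near_V unfolding S_def by blast
    then show "path_image (edge_path d e) \<subseteq> \<Omega>"
      using disj K1(2) by (auto simp: K_def)
  qed
  have T_edge: "path_image (edge_path d e) \<subseteq> \<Omega>" "path_image (edge_path d e) \<inter> W = {}"
    "path_image (edge_path d e) \<subseteq> K1" if "e \<in> boundary_edges T" for e
  proof -
    have near: "infdist z K \<le> 2 * d" if "z \<in> path_image (edge_path d e)" for z
      using boundary_edge_near \<open>e \<in> boundary_edges T\<close> that d(1) T_near unfolding T_def by blast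
    then show "path_image (edge_path d e) \<inter> W = {}"
      by (force simp: W_def)
    show "path_image (edge_path d e) \<subseteq> K1"
      using near d(1) by (force simp: K1_def)
    have "path_image (edge_path d e) \<subseteq> V"
      using near near_V d(1) by force
    moreover have "path_image (edge_path d e) \<inter> K = {}"
      using boundary_edge_avoids that d(1) by (simp add: T_def)
    ultimately show "path_image (edge_path d e) \<subseteq> \<Omega>"
      by (auto simp: K_def)
  qed
  have cont: "continuous_on X f" if "X \<subseteq> \<Omega>" for X
    using holomorphic_on_imp_continuous_on f that holomorphic_on_subset by metis
  define A where "A z = boundary_integral d S (\<lambda>w. f w / (w - z))" for z
  define B where "B z = boundary_integral d T (\<lambda>w. f w / (w - z))" for z
  have A: "A holomorphic_on U"
    unfolding A_def using S_edge cont by (intro boundary_integral_Cauchy_holomorphic) auto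
  have B: "B holomorphic_on W"
    unfolding B_def using T_edge cont by (intro boundary_integral_Cauchy_holomorphic) auto
  have U_K: "U - K \<subseteq> \<Omega>"
    using near_V d(1) by (force simp: U_def K_def)
  have K_W: "W \<inter> K = {}"
    using d(1) by (auto simp: W_def)
  have f_UK: "f holomorphic_on U - K"
    using f U_K holomorphic_on_subset by blast
  define g where "g z = A z - 2 * of_real pi * \<i> * f z" for z
  have g: "g holomorphic_on U - K"
    unfolding g_def by (intro holomorphic_intros f_UK holomorphic_on_subset[OF A]) auto
  \<comment> \<open>If \<open>g\<close> and \<open>B\<close> differ, they differ on an open set, which contains a point off the grid lines.\<close>
  have gB: "g z = B z" if z: "z \<in> U \<inter> W" for z
  proof (rule ccontr)
    assume neq: "g z \<noteq> B z"
    have "g holomorphic_on U \<inter> W" "B holomorphic_on U \<inter> W"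
      using g B K_W by (auto intro: holomorphic_on_subset)
    then have "continuous_on (U \<inter> W) (\<lambda>z. g z - B z)"
      by (intro continuous_intros holomorphic_on_imp_continuous_on)
    then have "open ((U \<inter> W) \<inter> (\<lambda>z. g z - B z) -` (- {0}))"
      using openUW by (intro continuous_open_preimage) auto
    moreover have "z \<in> (U \<inter> W) \<inter> (\<lambda>z. g z - B z) -` (- {0})"
      using z neq by auto
    ultimately obtain w q where "w \<in> (U \<inter> W) \<inter> (\<lambda>z. g z - B z) -` (- {0})"
      and q: "w \<in> interior (cell d q)" "\<forall>p. w \<in> cell d p \<longrightarrow> p = q"
      using interior_cell_point[OF _ _ d(1)] by meson
    then have w: "w \<in> U" "w \<in> W" "g w \<noteq> B w"
      by auto
    have wq: "w \<in> cell d q"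
      using q(1) interior_subset by blast
    have "q \<in> S"
      using w(1) wq by (auto simp: S_def cells_meeting_def K1_def U_def)
    moreover have "q \<notin> T"
      using w(2) infdist_cell[OF _ wq] T_near unfolding T_def W_def by force
    moreover have "f holomorphic_on cell d p" if p: "p \<in> S - T" for p
    proof -
      have "cell d p \<subseteq> V"
        using infdist_cell p S_near near_V unfolding S_def by blast
      moreover have "cell d p \<inter> K = {}"
        using p by (auto simp: T_def cells_meeting_def)
      ultimately show ?thesis
        using f by (intro holomorphic_on_subset[OF f]) (auto simp: K_def)
    qed
    ultimately have "A w = B w + 2 * of_real pi * \<i> * f w"
      unfolding A_def B_def
      using q(2) by (intro boundary_integral_Cauchy_difference[OF fin(1) TS d(1) _ q(1)]) auto
    then show False
      using w(3) by (simp add: g_def)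
  qed
  \<comment> \<open>The two expressions form one holomorphic function off \<open>K\<close>; that it vanishes identifies \<open>A\<close> with \<open>2 \<pi> \<i> f\<close>.\<close>
  define G where "G z = (if z \<in> W then B z else g z)" for z
  have "G holomorphic_on W"
    using holomorphic_transform[OF B] by (simp add: G_def)
  moreover have "G holomorphic_on U - K"
    using holomorphic_transform[OF g] gB by (auto simp: G_def)
  moreover have "open (U - K)"
    using openUW(1) K(1) compact_imp_closed by (intro open_Diff)
  ultimately have "G holomorphic_on W \<union> (U - K)"
    using openUW(2) by (intro holomorphic_on_Un)
  moreover have "W \<union> (U - K) = - K"
    using K_W d(1) by (auto simp: W_def U_def)
  ultimately have G: "G holomorphic_on - K"
    by simp
  obtain R where R: "R > 0" "K1 \<subseteq> cball 0 R"
    using bounded_subset_ballD[OF compact_imp_bounded[OF K1(1)]] ball_subset_cball by (meson order_trans)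
  have moments: "boundary_integral d T (\<lambda>w. w ^ n * f w) = 0" for n
  proof -
    obtain h where "\<forall>z\<in>\<Omega>. (h has_field_derivative z ^ n * f z) (at z)"
      using mom by blast
    then show ?thesis
      using T_edge(1) by (intro boundary_integral_derivative[OF fin(2), where h = h]) blast
  qed
  have G0: "G z = 0" if z: "z \<in> - cball 0 R" for z
  proof -
    have "z \<in> W"
      using z R(2) d(1) by (force simp: K1_def W_def)
    moreover have "B z = 0"
      unfolding B_def boundary_integral_def edge_path_def
    proof (rule Cauchy_transform_zero_if_moments_zero[where R = R])
      show "finite (boundary_edges T)"
        by (rule finite_boundary_edges[OF fin(2)])
      show "(\<Sum>e\<in>boundary_edges T. contour_integral (linepath (grid_point d (fst e)) (grid_point d (snd e)))
          (\<lambda>w. w ^ n * f w)) = 0" for n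
        using moments[of n] by (simp add: boundary_integral_def edge_path_def)
      show "continuous_on (closed_segment (grid_point d (fst e)) (grid_point d (snd e))) f"
        if "e \<in> boundary_edges T" for e
        using cont T_edge(1)[OF that] by (simp add: path_image_edge_path)
      show "norm w \<le> R" if "e \<in> boundary_edges T"
        "w \<in> closed_segment (grid_point d (fst e)) (grid_point d (snd e))" for e w
        using T_edge(3)[OF that(1)] that(2) R(2) by (force simp: path_image_edge_path)
      show "R < norm z" "0 \<le> R"
        using z R(1) by auto
    qed
    ultimately show ?thesis
      by (simp add: G_def)
  qed
  have zero: "G z = 0" if "z \<in> - K" for z
  proof (rule analytic_continuation_open[of "- cball 0 R" "- K" G "\<lambda>_. 0" z])
    show "open (- K)" using K(1) compact_imp_closed by auto
    have "complex_of_real (R + 1) \<in> - cball 0 R"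
      using R(1) by simp
    then show "- cball 0 R \<noteq> ({} :: complex set)" by blast
    show "- cball 0 R \<subseteq> - K"
      using R(2) K1(2) by auto
  qed (use that G G0 K(3) in \<open>auto\<close>)
  have "A z / (2 * of_real pi * \<i>) = f z" if z: "z \<in> U \<inter> \<Omega>" for z
  proof -
    have zK: "z \<in> U - K" "z \<in> - K"
      using z by (auto simp: K_def)
    then have "g z = 0"
      using zero[OF zK(2)] gB[of z] by (auto simp: G_def split: if_splits)
    then show ?thesis
      by (simp add: g_def field_simps)
  qed
  moreover have "(\<lambda>z. A z / (2 * of_real pi * \<i>)) holomorphic_on U"
    by (intro holomorphic_intros A) auto
  moreover have "V - \<Omega> \<subseteq> U"
    using d(1) by (auto simp: U_def K_def[symmetric])
  moreover have "U \<subseteq> V"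
    using d(1) near_V by (auto simp: U_def)
  ultimately show ?thesis
    using openUW(1) by (intro exI[of _ U] exI[of _ "\<lambda>z. A z / (2 * of_real pi * \<i>)"]) blast
qed

section \<open>Gluing the local extensions\<close>

text \<open>
  Two extensions can differ only at points of the two compact pieces, so the set where they differ has
  compact closure inside both domains; on its boundary they agree, and the maximum principle
  excludes a difference inside.
\<close>

lemma extensions_agree:
  assumes "open \<Omega>" "open U1" "open U2" and K: "compact (U1 - \<Omega>)" "compact (U2 - \<Omega>)"
    and F: "F1 holomorphic_on U1" "F2 holomorphic_on U2"
    and eq: "\<And>z. z \<in> U1 \<inter> U2 \<inter> \<Omega> \<Longrightarrow> F1 z = F2 z" and z: "z \<in> U1 \<inter> U2"
  shows "F1 z = F2 z"
proof (rule ccontr)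
  assume neq: "F1 z \<noteq> F2 z"
  define h where "h z = F1 z - F2 z" for z
  define N where "N = (U1 \<inter> U2) \<inter> h -` (- {0})"
  have h: "h holomorphic_on U1 \<inter> U2"
    unfolding h_def using F by (intro holomorphic_intros) (auto intro: holomorphic_on_subset)
  have "open N"
    unfolding N_def using assms(2,3) holomorphic_on_imp_continuous_on[OF h]
    by (intro continuous_open_preimage) auto
  have "N \<subseteq> (U1 - \<Omega>) \<inter> (U2 - \<Omega>)"
    using eq by (auto simp: N_def h_def)
  moreover have "closed ((U1 - \<Omega>) \<inter> (U2 - \<Omega>))"
    using K compact_imp_closed by blast
  ultimately have cl: "closure N \<subseteq> (U1 - \<Omega>) \<inter> (U2 - \<Omega>)"
    by (rule closure_minimal)
  then have sub: "closure N \<subseteq> U1 \<inter> U2"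
    by blast
  have "bounded N"
    using cl closure_subset K(1) compact_imp_bounded bounded_subset by (metis inf.boundedE)
  have "norm (h z) \<le> 0"
  proof (rule maximum_modulus_frontier[of h N 0 z])
    show "h holomorphic_on interior N"
      using h sub interior_subset closure_subset by (blast intro: holomorphic_on_subset)
    show "continuous_on (closure N) h"
      using holomorphic_on_imp_continuous_on[OF h] sub continuous_on_subset by blast
    show "norm (h x) \<le> 0" if x: "x \<in> frontier N" for x
    proof -
      have "x \<in> closure N" "x \<notin> N"
        using x \<open>open N\<close> by (auto simp: frontier_def interior_open)
      then show ?thesis
        using sub by (auto simp: N_def)
    qed
    show "z \<in> N"
      using z neq by (simp add: N_def h_def)
  qed fact
  then show False
    using neq by (simp add: h_def)
qed

text \<open>
  Each inside point has a neighbourhood that \<open>f\<close> extends to; at a point \<open>z\<close> not in \<open>\<Omega>\<close> the value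
  of the global extension is taken from the neighbourhood chosen for \<open>z\<close> itself, and agreement of local
  extensions makes this coincide with the one chosen for any other point nearby.
\<close>

lemma extension_to_hull:
  assumes dom: "complex_domain \<Omega>" and f: "f holomorphic_on \<Omega>"
    and mom: "\<And>n. \<exists>h. \<forall>z\<in>\<Omega>. (h has_field_derivative z ^ n * f z) (at z)"
  shows "has_holomorphic_extension \<Omega> f (- outside \<Omega>)"
proof -
  have \<Omega>: "\<Omega> \<noteq> {}" "open \<Omega>" "connected \<Omega>"
    using dom by (auto simp: complex_domain_def)
  define local_ext where "local_ext x U F \<longleftrightarrow>
      open U \<and> x \<in> U \<and> compact (U - \<Omega>) \<and> F holomorphic_on U \<and> (\<forall>z\<in>U \<inter> \<Omega>. F z = f z)" for x U F
  have "\<exists>U F. local_ext x U F" if x: "x \<in> inside \<Omega>" for x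
  proof -
    obtain V where V: "open V" "x \<in> V" "compact (V - \<Omega>)"
      using compact_piece_of_complement[OF \<Omega>(2) x] .
    have xV: "x \<in> V - \<Omega>"
      using V(2) x by (auto simp: inside_def)
    then have "V - \<Omega> \<noteq> {}" by blast
    then obtain U F where U: "open U" "V - \<Omega> \<subseteq> U" "U \<subseteq> V" "F holomorphic_on U" "\<forall>z\<in>U \<inter> \<Omega>. F z = f z"
      using extension_across_compact[OF \<Omega>(2) f V(1,3) _ connected_complement_of_piece[OF \<Omega>(3,1) V(1,3)] mom]
      by blast
    have "U - \<Omega> = V - \<Omega>"
      using U(2,3) by blast
    then have "compact (U - \<Omega>)"
      using V(3) by simp
    then show ?thesis
      using U xV unfolding local_ext_def by blast
  qed
  then obtain U F where "\<And>x. x \<in> inside \<Omega> \<Longrightarrow> local_ext x (U x) (F x)"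
    by metis
  then have U: "\<And>x. x \<in> inside \<Omega> \<Longrightarrow> open (U x)" "\<And>x. x \<in> inside \<Omega> \<Longrightarrow> x \<in> U x"
     "\<And>x. x \<in> inside \<Omega> \<Longrightarrow> compact (U x - \<Omega>)" "\<And>x. x \<in> inside \<Omega> \<Longrightarrow> F x holomorphic_on U x"
     "\<And>x z. x \<in> inside \<Omega> \<Longrightarrow> z \<in> U x \<Longrightarrow> z \<in> \<Omega> \<Longrightarrow> F x z = f z"
    unfolding local_ext_def by blast+
  define H where "H z = (if z \<in> \<Omega> then f z else F z z)" for z
  have H: "H z = F x z" if x: "x \<in> inside \<Omega>" and z: "z \<in> U x" for x z
  proof (cases "z \<in> \<Omega>")
    case False
    then have zi: "z \<in> inside \<Omega>"
      using compact_piece_subset_inside[OF U(1)[OF x] U(3)[OF x]] z by blast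
    have "F z z = F x z"
      by (rule extensions_agree[of \<Omega> "U z" "U x"]) (use \<Omega>(2) U x zi z in auto)
    then show ?thesis
      using False by (simp add: H_def)
  qed (use U x z in \<open>auto simp: H_def\<close>)
  have "H holomorphic_on \<Omega> \<union> (\<Union>x\<in>inside \<Omega>. U x)"
  proof (rule holomorphic_on_Un)
    show "H holomorphic_on \<Omega>"
      using f by (rule holomorphic_transform) (simp add: H_def)
    show "H holomorphic_on (\<Union>x\<in>inside \<Omega>. U x)"
    proof (rule holomorphic_on_UN_open)
      show "H holomorphic_on U x" if "x \<in> inside \<Omega>" for x
        using U(4)[OF that] by (rule holomorphic_transform) (simp add: H[OF that])
    qed (rule U(1))
  qed (use \<Omega>(2) U(1) in auto)
  moreover have "- outside \<Omega> \<subseteq> \<Omega> \<union> (\<Union>x\<in>inside \<Omega>. U x)"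
    using U(2) by (auto simp: outside_inside)
  ultimately have "H holomorphic_on - outside \<Omega>"
    by (rule holomorphic_on_subset)
  then show ?thesis
    unfolding has_holomorphic_extension_def by (intro exI[of _ H]) (auto simp: H_def)
qed

theorem theorem3:
  fixes \<Omega> :: "complex set" and f :: "complex \<Rightarrow> complex"
  assumes "complex_domain \<Omega>"
    and "f holomorphic_on \<Omega>"
  shows "Some ` simply_connected_hull \<Omega> = topspace riemann_sphere - component_of_infinity \<Omega>
    \<and> (has_primitives_of_all_orders \<Omega> f \<longleftrightarrow>
         (\<forall>\<gamma> P. closed_polygonal_line_in \<Omega> \<gamma> \<longrightarrow>
            contour_integral \<gamma> (\<lambda>z. poly P z * f z) = 0))
    \<and> ((\<forall>\<gamma> P. closed_polygonal_line_in \<Omega> \<gamma> \<longrightarrow>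
            contour_integral \<gamma> (\<lambda>z. poly P z * f z) = 0) \<longleftrightarrow>
         has_holomorphic_extension \<Omega> f (simply_connected_hull \<Omega>))"
    (is "?hull \<and> (?prim \<longleftrightarrow> ?poly) \<and> (?poly \<longleftrightarrow> ?ext)")
proof -
  have \<Omega>: "open \<Omega>" "connected \<Omega>"
    using assms(1) by (auto simp: complex_domain_def)
  have hull: "simply_connected_hull \<Omega> = - outside \<Omega>"
    by (rule simply_connected_hull_eq[OF assms(1)])
  have "?hull"
    unfolding hull component_of_infinity_eq[OF \<Omega>(1)] by (auto simp: riemann_sphere_def)
  moreover have "?poly" if "?prim"
    using polygon_integrals_zero_if_primitives[OF \<Omega>(1) that] by blast
  moreover have "?ext" if poly: "?poly"
  proof -
    have "\<exists>h. \<forall>z\<in>\<Omega>. (h has_field_derivative z ^ n * f z) (at z)" for n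
    proof (rule primitive_if_polygon_integrals_zero[OF \<Omega>])
      show "(\<lambda>z. z ^ n * f z) holomorphic_on \<Omega>"
        using assms(2) by (intro holomorphic_intros)
      show "contour_integral \<gamma> (\<lambda>z. z ^ n * f z) = 0" if "closed_polygonal_line_in \<Omega> \<gamma>" for \<gamma>
        using poly[rule_format, OF that, of "monom 1 n"] by (simp add: poly_monom)
    qed
    then show ?thesis
      unfolding hull by (rule extension_to_hull[OF assms])
  qed
  moreover have "?prim" if "?ext"
    by (rule primitives_if_extension[OF Un_inside_simply_connected_domain[OF assms(1)] \<Omega>(1)])
       (use that in \<open>auto simp: hull outside_def\<close>)
  ultimately show ?thesis by argo
qed

end
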